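(* Let $0<\alpha<1$ and let $a$ be a fixed cut-off function as in the context. There are constants $c,C>0$ and $\gamma_0,\lambda_0\ge 1$, with $c,C$ independent of $\lambda$, $\gamma$ and $p$, such that for all $\lambda\ge\lambda_0$ and $\gamma\ge\gamma_0$ with $N=\gamma\lambda$ an integer, and all $p\in[0,1]$, the random wave $u(x)=\sum_{j=1}^{N}C_j e^{i\lambda x\cdot\xi_j}$, $x\in\mathbb{R}^2$, with directions $\xi_1,\dots,\xi_N$ equally spaced on the unit circle and independent coefficients $C_j$ each equal to $+1$ with probability $p$ and $-1$ with probability $1-p$, satisfies $$c\left(\gamma\lambda^{1-2\alpha}+(2p-1)^2\gamma^2\lambda^{1-\alpha}\right)\le\mathbb{E}\left[\|a_\lambda u\|_{L^2}^2\right]\le C\left(\gamma\lambda^{1-2\alpha}+(2p-1)^2\gamma^2\lambda^{1-\alpha}\right).$$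
   Context: The cut-off $a:\mathbb{R}\to\mathbb{R}$ is a fixed smooth function supported on $[-2,2]$ and equal to $1$ on $[-1,1]$. For $x\in\mathbb{R}^2$ put $a_\lambda(x)=a(\lambda^\alpha|x|)$, so $\|a_\lambda u\|_{L^2}^2=\int_{\mathbb{R}^2}a^2(\lambda^\alpha|x|)\,|u(x)|^2\,dx$. The $N=\gamma\lambda$ directions $\xi_j$ lie on the unit circle $\mathbb{S}\subset\mathbb{R}^2$, with angle $2\pi/(\gamma\lambda)$ between consecutive directions. $\mathbb{E}$ is expectation over the random coefficients $C_1,\dots,C_N$. *)

theory Defs
  imports "HOL-Probability.Probability"
begin

definition smooth :: "(real \<Rightarrow> real) \<Rightarrow> bool" where
  "smooth f \<longleftrightarrow> (\<forall>n. (deriv ^^ n) f differentiable_on UNIV)"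

definition cutoff :: "(real \<Rightarrow> real) \<Rightarrow> bool" where
  "cutoff a \<longleftrightarrow> smooth a \<and> closure {t. a t \<noteq> 0} \<subseteq> {-2..2} \<and> (\<forall>t\<in>{-1..1}. a t = 1)"

definition scaled_cutoff :: "(real \<Rightarrow> real) \<Rightarrow> real \<Rightarrow> real \<Rightarrow> real^2 \<Rightarrow> real" where
  "scaled_cutoff a \<alpha> lam x = a (lam powr \<alpha> * norm x)"

definition L2norm :: "(real^2 \<Rightarrow> complex) \<Rightarrow> real" where
  "L2norm f = sqrt (LINT x|lborel. (cmod (f x))\<^sup>2)"

(* The position of the first direction is arbitrary; the enumeration is counterclockwise. *)
definition equally_spaced :: "nat \<Rightarrow> (nat \<Rightarrow> real^2) \<Rightarrow> bool" where
  "equally_spaced N \<xi> \<longleftrightarrow>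
     (\<exists>\<theta>. \<forall>j\<in>{1..N}. \<xi> j = vector [cos (\<theta> + 2 * pi * real j / real N),
                                    sin (\<theta> + 2 * pi * real j / real N)])"

definition wave :: "real \<Rightarrow> nat \<Rightarrow> (nat \<Rightarrow> real^2) \<Rightarrow> (nat \<Rightarrow> real) \<Rightarrow> real^2 \<Rightarrow> complex" where
  "wave lam N \<xi> b x =
     (\<Sum>j=1..N. complex_of_real (b j) * exp (\<i> * complex_of_real (lam * (x \<bullet> \<xi> j))))"

definition random_signs ::
    "'w measure \<Rightarrow> nat \<Rightarrow> real \<Rightarrow> (nat \<Rightarrow> 'w \<Rightarrow> real) \<Rightarrow> bool" where
  "random_signs M N p Cf \<longleftrightarrow>
     prob_space M \<and> prob_space.indep_vars M (\<lambda>_. borel) Cf {1..N} \<and>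
     (\<forall>j\<in>{1..N}. measure M {\<omega> \<in> space M. Cf j \<omega> = 1} = p \<and>
                 measure M {\<omega> \<in> space M. Cf j \<omega> = -1} = 1 - p)"

end

(* After taking expectations, E|u|^2 is the nonnegative trigonometric polynomial
   sum_{j,k} m_{jk} cos(lam x.(xi_j - xi_k)) with m_{jk} = 1 on the diagonal and (2p-1)^2 off it.
   By nonnegativity the cut-off a^2 may be squeezed between combinations of Gaussians,
     exp(-2 t^2) - exp(-1 - t^2) <= a(t)^2 <= A exp(-t^2)   (t >= 0),
   whose Fourier transforms are explicit. With L = lam^(1-alpha) this leaves the sums
   sum_{j,k} m_{jk} exp(-L^2 |xi_j - xi_k|^2 / kappa). For equally spaced directions about N/L of
   the terms in each row are of order 1 and the others decay, so these sums are comparable to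
   N + (2p-1)^2 N^2 / L. *)

theory Submission
  imports Defs
begin

section \<open>Fourier integrals of Gaussians\<close>

lemma gaussian_has_fourier_integral_real:
  fixes b \<eta> :: real
  assumes "b > 0"
  shows "has_bochner_integral lborel
    (\<lambda>t. complex_of_real (exp (- b * t\<^sup>2)) * exp (\<i> * complex_of_real (t * \<eta>)))
    (complex_of_real (sqrt (pi / b) * exp (- \<eta>\<^sup>2 / (4 * b))))"
proof -
  \<comment> \<open>With s^2 = 2b, replacing t by s t turns exp(-t^2/2) into exp(-b t^2). The result
    is thus a rescaling of the characteristic function of the standard normal distribution at
    \<open>\<eta> / s\<close>.\<close>
  define s where "s = sqrt (2 * b)"
  have s: "s > 0" "s\<^sup>2 = 2 * b"
    using assms by (auto simp: s_def)
  define g where "g = (\<lambda>t. std_normal_density t *\<^sub>R exp (\<i> * complex_of_real (\<eta> / s * t)))"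
  have g_int: "integrable lborel g"
    unfolding g_def
  proof (rule Bochner_Integration.integrable_bound)
    show "integrable lborel std_normal_density"
      by (rule integrable_normal_density) simp
    show "AE t in lborel. norm (std_normal_density t *\<^sub>R exp (\<i> * complex_of_real (\<eta> / s * t)))
        \<le> norm (std_normal_density t)"
      by (simp flip: of_real_mult of_real_divide)
  qed measurable
  have "integral\<^sup>L lborel g = char std_normal_distribution (\<eta> / s)"
    unfolding char_def g_def by (subst integral_density) auto
  also have "\<dots> = complex_of_real (exp (- (\<eta> / s)\<^sup>2 / 2))"
    by (simp add: char_std_normal_distribution)
  also have "- (\<eta> / s)\<^sup>2 / 2 = - \<eta>\<^sup>2 / (4 * b)"
    by (simp add: power_divide s)
  finally have g_eq: "integral\<^sup>L lborel g = complex_of_real (exp (- \<eta>\<^sup>2 / (4 * b)))" .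
  have "integral\<^sup>L lborel g = \<bar>s\<bar> *\<^sub>R (\<integral>t. g (0 + s * t) \<partial>lborel)"
    using s by (intro lborel_integral_real_affine) simp
  hence scaled: "(\<integral>t. g (s * t) \<partial>lborel) = integral\<^sup>L lborel g / complex_of_real s"
    using s by (simp add: scaleR_conv_of_real)
  have g_s: "complex_of_real (sqrt (2 * pi)) * g (s * t)
      = complex_of_real (exp (- b * t\<^sup>2)) * exp (\<i> * complex_of_real (t * \<eta>))" for t
    using s by (simp add: g_def std_normal_density_def scaleR_conv_of_real power_mult_distrib mult.commute)
  have "integrable lborel (\<lambda>t. g (0 + s * t))"
    using g_int s by (intro lborel_integrable_real_affine) auto
  hence "has_bochner_integral lborel (\<lambda>t. complex_of_real (sqrt (2 * pi)) * g (s * t))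
     (complex_of_real (sqrt (2 * pi)) * (integral\<^sup>L lborel g / complex_of_real s))"
    unfolding scaled[symmetric] by (intro has_bochner_integral_mult_right has_bochner_integral_integrable) simp
  moreover have "complex_of_real (sqrt (2 * pi)) * (integral\<^sup>L lborel g / complex_of_real s)
     = complex_of_real (sqrt (pi / b) * exp (- \<eta>\<^sup>2 / (4 * b)))"
  proof -
    have "sqrt (2 * pi) / s = sqrt (pi / b)"
      unfolding s_def using assms by (simp flip: real_sqrt_divide)
    thus ?thesis
      unfolding g_eq by (metis (no_types, lifting) of_real_divide of_real_mult times_divide_eq_left times_divide_eq_right)
  qed
  ultimately show ?thesis
    by (simp only: g_s)
qed

text \<open>In the coordinates of \<open>Basis\<close> the integrand is a product of one-variable
  integrands, so integration over a product measure reduces everything to the one-dimensional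
  formula.\<close>

lemma gaussian_has_fourier_integral:
  fixes \<eta> :: "'a::euclidean_space"
  assumes "b > 0"
  shows "has_bochner_integral lborel
    (\<lambda>x. complex_of_real (exp (- b * (norm x)\<^sup>2)) * exp (\<i> * complex_of_real (x \<bullet> \<eta>)))
    (complex_of_real (sqrt (pi / b) ^ DIM('a) * exp (- (norm \<eta>)\<^sup>2 / (4 * b))))"
proof -
  interpret product_sigma_finite "\<lambda>_::'a. lborel :: real measure" ..
  define f where "f = (\<lambda>(i::'a) (t::real).
    complex_of_real (exp (- b * t\<^sup>2)) * exp (\<i> * complex_of_real (t * (\<eta> \<bullet> i))))"
  define F where "F = (\<lambda>x::'a. complex_of_real (exp (- b * (norm x)\<^sup>2)) * exp (\<i> * complex_of_real (x \<bullet> \<eta>)))"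
  have f_int: "integrable lborel (f i)"
    and f_eq: "integral\<^sup>L lborel (f i) = complex_of_real (sqrt (pi / b) * exp (- (\<eta> \<bullet> i)\<^sup>2 / (4 * b)))" for i
    using gaussian_has_fourier_integral_real[OF assms, of "\<eta> \<bullet> i"]
    by (auto simp: f_def has_bochner_integral_iff)
  have F_prod: "F (\<Sum>i\<in>Basis. v i *\<^sub>R i) = (\<Prod>i\<in>Basis. f i (v i))" for v :: "'a \<Rightarrow> real"
  proof -
    let ?x = "\<Sum>i\<in>Basis. v i *\<^sub>R i"
    have x: "?x \<bullet> i = v i" if "i \<in> Basis" for i
      using that by simp
    have "(norm ?x)\<^sup>2 = (\<Sum>i\<in>Basis. (v i)\<^sup>2)"
      unfolding power2_norm_eq_inner by (subst euclidean_inner) (simp add: power2_eq_square)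
    moreover have "?x \<bullet> \<eta> = (\<Sum>i\<in>Basis. v i * (\<eta> \<bullet> i))"
      by (subst euclidean_inner) simp
    ultimately show ?thesis
      by (simp add: F_def f_def prod.distrib sum_distrib_left exp_sum flip: sum_negf of_real_prod)
  qed
  have [measurable]: "F \<in> borel_measurable borel"
    unfolding F_def by measurable
  have "integrable (\<Pi>\<^sub>M i\<in>Basis. lborel) (\<lambda>v. F (\<Sum>i\<in>Basis. v i *\<^sub>R i))"
    unfolding F_prod by (intro product_integrable_prod f_int) auto
  moreover have "(\<integral>v. F (\<Sum>i\<in>Basis. v i *\<^sub>R i) \<partial>(\<Pi>\<^sub>M i\<in>Basis. lborel))
      = (\<Prod>i\<in>Basis. integral\<^sup>L lborel (f i))"
    unfolding F_prod by (intro product_integral_prod f_int) auto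
  moreover have "(\<Prod>i\<in>Basis. integral\<^sup>L lborel (f i))
     = complex_of_real (sqrt (pi / b) ^ DIM('a) * exp (- (norm \<eta>)\<^sup>2 / (4 * b)))"
  proof -
    have "(norm \<eta>)\<^sup>2 = (\<Sum>i\<in>Basis. (\<eta> \<bullet> i)\<^sup>2)"
      unfolding power2_norm_eq_inner by (subst euclidean_inner) (simp add: power2_eq_square)
    thus ?thesis
      by (simp add: f_eq prod.distrib exp_sum sum_divide_distrib flip: sum_negf of_real_prod)
  qed
  \<comment> \<open>\<open>lborel\<close> is the image of the product measure under v -> sum of v_i
    i; both the integrability and the value are transported along this map.\<close>
  ultimately show ?thesis
    unfolding has_bochner_integral_iff F_def[symmetric]
    by (subst (1 2) lborel_eq) (auto simp: integrable_distr_eq integral_distr)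
qed

text \<open>The real part of the Fourier integral in dimension 2, where the prefactor
  \<open>sqrt (pi / b)\<close> squared becomes \<open>pi / b\<close>.\<close>

lemma gaussian_has_cosine_integral:
  fixes \<eta> :: "real^2"
  assumes "b > 0"
  shows "has_bochner_integral lborel (\<lambda>x. exp (- b * (norm x)\<^sup>2) * cos (x \<bullet> \<eta>))
    (pi / b * exp (- (norm \<eta>)\<^sup>2 / (4 * b)))"
proof -
  have "has_bochner_integral lborel
    (\<lambda>x. Re (complex_of_real (exp (- b * (norm x)\<^sup>2)) * exp (\<i> * complex_of_real (x \<bullet> \<eta>))))
    (Re (complex_of_real (sqrt (pi / b) ^ DIM(real^2) * exp (- (norm \<eta>)\<^sup>2 / (4 * b)))))"
    by (intro has_bochner_integral_Re gaussian_has_fourier_integral assms)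
  thus ?thesis
    using assms by (simp add: Re_exp)
qed

section \<open>Gaussian sums over equally spaced directions\<close>

lemma sum_gaussian_le:
  fixes \<epsilon> :: real
  assumes "\<epsilon> > 0"
  shows "(\<Sum>d\<le>n. exp (- (\<epsilon> * real d)\<^sup>2)) \<le> 2 + 2 / \<epsilon>"
proof -
  let ?r = "exp (- \<epsilon>)"
  \<comment> \<open>Completing the square bounds -y^2 + y by 1/4, and exp(1/4) is at most 2. This
    trades the Gaussian for a geometric series, whose sum 1/(1 - exp(-\<epsilon>)) is at most 1 +
    1/\<epsilon>.\<close>
  have le: "exp (- y\<^sup>2) \<le> 2 * exp (- y)" for y :: real
  proof -
    have "- y\<^sup>2 + y = 1 / 4 - (y - 1 / 2)\<^sup>2"
      by (simp add: power2_eq_square algebra_simps)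
    hence "exp (- y\<^sup>2 + y) \<le> exp (1 / 4)"
      by simp
    also have "\<dots> \<le> (2::real)"
      using exp_bound[of "1/4::real"] by (simp add: power2_eq_square)
    finally have "exp (- y\<^sup>2 + y) * exp (- y) \<le> 2 * exp (- y)"
      by (intro mult_right_mono) auto
    thus ?thesis
      by (simp flip: exp_add)
  qed
  have r: "0 < ?r" "?r < 1"
    using assms by auto
  have "(\<Sum>d\<le>n. exp (- (\<epsilon> * real d)\<^sup>2)) \<le> (\<Sum>d\<le>n. 2 * ?r ^ d)"
    by (intro sum_mono order.trans[OF le]) (simp add: mult.commute flip: exp_of_nat_mult)
  also have "\<dots> = 2 * (\<Sum>d<Suc n. ?r ^ d)"
    by (simp add: sum_distrib_left lessThan_Suc_atMost)
  also have "\<dots> \<le> 2 * (\<Sum>d. ?r ^ d)"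
    using r by (intro mult_left_mono sum_le_suminf) (auto intro: summable_geometric)
  also have "(\<Sum>d. ?r ^ d) = 1 / (1 - ?r)"
    using r by (intro suminf_geometric) auto
  also have "1 / (1 - ?r) \<le> 1 + 1 / \<epsilon>"
  proof -
    have "?r \<le> 1 / (1 + \<epsilon>)"
      using exp_ge_add_one_self[of \<epsilon>] assms by (simp add: exp_minus field_simps)
    hence "\<epsilon> / (1 + \<epsilon>) \<le> 1 - ?r"
      using assms by (simp add: field_simps)
    hence "1 / (1 - ?r) \<le> 1 / (\<epsilon> / (1 + \<epsilon>))"
      using assms by (intro divide_left_mono) auto
    thus ?thesis
      using assms by (simp add: field_simps)
  qed
  finally show ?thesis
    by simp
qed

lemma norm_diff_polar:
  fixes s t :: real
  shows "norm (vector [cos s, sin s] - vector [cos t, sin t] :: real^2) = 2 * \<bar>sin ((s - t) / 2)\<bar>"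
proof -
  have "(norm (vector [cos s, sin s] - vector [cos t, sin t] :: real^2))\<^sup>2
      = (cos s - cos t)\<^sup>2 + (sin s - sin t)\<^sup>2"
    unfolding power2_norm_eq_inner inner_vec_def by (simp add: sum_2 vector_2 power2_eq_square)
  also have "\<dots> = 2 - 2 * cos (s - t)"
    using sin_cos_squared_add[of s] sin_cos_squared_add[of t]
    by (simp add: cos_diff power2_diff algebra_simps)
  also have "\<dots> = (2 * \<bar>sin ((s - t) / 2)\<bar>)\<^sup>2"
  proof -
    have "cos (s - t) = 1 - 2 * (sin ((s - t) / 2))\<^sup>2"
      by (metis cos_double_sin field_sum_of_halves mult_2)
    thus ?thesis
      by (simp add: power_mult_distrib)
  qed
  finally show ?thesis
    by (rule power2_eq_imp_eq) auto
qed

text \<open>The starting angle cancels in the difference, and a chord is twice the sine of half its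
  central angle.\<close>

lemma equally_spaced_norm_diff:
  assumes "equally_spaced N \<xi>" "j \<in> {1..N}" "k \<in> {1..N}"
  shows "norm (\<xi> j - \<xi> k) = 2 * \<bar>sin (pi * (real j - real k) / real N)\<bar>"
proof -
  obtain \<theta> where \<theta>: "\<And>j. j \<in> {1..N} \<Longrightarrow> \<xi> j = vector [cos (\<theta> + 2 * pi * real j / real N),
                                    sin (\<theta> + 2 * pi * real j / real N)]"
    using assms(1) unfolding equally_spaced_def by blast
  have "(\<theta> + 2 * pi * real j / real N - (\<theta> + 2 * pi * real k / real N)) / 2
      = pi * (real j - real k) / real N"
    by (simp add: diff_divide_distrib right_diff_distrib)
  thus ?thesis
    unfolding \<theta>[OF assms(2)] \<theta>[OF assms(3)] norm_diff_polar by simp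
qed

text \<open>Jordan's inequality: sine is concave on [0, pi], so on [0, pi/2] it lies above the chord
  joining its values at the endpoints.\<close>

lemma sin_ge_two_over_pi:
  fixes x :: real
  assumes "0 \<le> x" "x \<le> pi / 2"
  shows "2 * x / pi \<le> sin x"
proof -
  have "concave_on {0..pi} sin"
    by (rule f''_le0_imp_concave[where f' = cos and f'' = "\<lambda>x. - sin x"])
      (auto intro!: derivative_eq_intros sin_ge_zero)
  hence "(1 - 2 * x / pi) * sin 0 + 2 * x / pi * sin (pi / 2) \<le> sin ((1 - 2 * x / pi) *\<^sub>R 0 + (2 * x / pi) *\<^sub>R (pi / 2))"
    using assms by (intro concave_onD) (auto simp: field_simps)
  thus ?thesis
    by simp
qed

text \<open>By Jordan's inequality, a direction d steps away along the shorter arc is at distance at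
  least 4d/N. A row is therefore dominated by Gaussian sums with step 2L/N, each of order
  N/L.\<close>

lemma sum_gaussian_chord_le:
  fixes L :: real
  assumes "equally_spaced N \<xi>" "j \<in> {1..N}" "L \<ge> 1" "real N \<ge> L"
  shows "(\<Sum>k=1..N. exp (- L\<^sup>2 * (norm (\<xi> j - \<xi> k))\<^sup>2 / 4)) \<le> 12 * real N / L"
proof -
  define h where "h = (\<lambda>d. exp (- (2 * L / real N * real d)\<^sup>2))"
  have N: "real N > 0"
    using assms by linarith
  \<comment> \<open>The index difference d may follow the longer arc. Since sin(pi d/N) = sin(pi (N
    - d)/N), one of d and N - d is at most N/2 and obeys Jordan's inequality; adding both terms
    avoids carrying the case distinction further.\<close>
  have sin_ge: "exp (- L\<^sup>2 * (2 * \<bar>sin (pi * real d / real N)\<bar>)\<^sup>2 / 4) \<le> h d + h (N - d)" if "d \<le> N" for d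
  proof -
    have *: "exp (- L\<^sup>2 * (2 * \<bar>sin (pi * real e / real N)\<bar>)\<^sup>2 / 4) \<le> h e" if "2 * e \<le> N" for e
    proof -
      have "2 * (pi * real e / real N) / pi \<le> sin (pi * real e / real N)"
        using that N by (intro sin_ge_two_over_pi) (auto simp: field_simps)
      hence "2 * real e / real N \<le> \<bar>sin (pi * real e / real N)\<bar>"
        by simp
      hence "L * (2 * real e / real N) \<le> L * \<bar>sin (pi * real e / real N)\<bar>"
        using assms by (intro mult_left_mono) auto
      hence "(L * (2 * real e / real N))\<^sup>2 \<le> (L * \<bar>sin (pi * real e / real N)\<bar>)\<^sup>2"
        using assms by (intro power_mono) auto
      thus ?thesis
        by (simp add: h_def power_mult_distrib power_divide mult_ac)
    qed
    show ?thesis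
    proof (cases "2 * d \<le> N")
      case True
      thus ?thesis
        using *[of d] by (simp add: h_def add_increasing2)
    next
      case False
      have "pi * real (N - d) / real N = pi - pi * real d / real N"
        using that N by (simp add: of_nat_diff field_simps)
      hence "sin (pi * real (N - d) / real N) = sin (pi * real d / real N)"
        by simp
      thus ?thesis
        using *[of "N - d"] False by (simp add: h_def add_increasing)
    qed
  qed
  have h_sum: "(\<Sum>d\<le>N. h d) \<le> 3 * real N / L"
  proof -
    have "(\<Sum>d\<le>N. h d) \<le> 2 + 2 / (2 * L / real N)"
      unfolding h_def using assms N by (intro sum_gaussian_le) simp
    also have "\<dots> = 2 + real N / L"
      by simp
    \<comment> \<open>\<open>L \<le> real N\<close> absorbs the additive 2 into 2N/L.\<close>
    also have "\<dots> \<le> 3 * real N / L"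
      using assms by (simp add: field_simps)
    finally show ?thesis .
  qed
  have h_sum': "(\<Sum>d\<le>N. h d + h (N - d)) \<le> 6 * real N / L"
  proof -
    have "(\<Sum>d\<le>N. h (N - d)) = (\<Sum>d\<le>N. h d)"
      using sum.nat_diff_reindex[of h "Suc N"] by (simp add: lessThan_Suc_atMost)
    thus ?thesis
      using h_sum by (simp add: sum.distrib)
  qed
  have h_nonneg: "h d \<ge> 0" for d
    by (simp add: h_def)
  have dist: "exp (- L\<^sup>2 * (norm (\<xi> j - \<xi> k))\<^sup>2 / 4) \<le> h d + h (N - d)"
    if "k \<in> {1..N}" "d \<le> N" "real d = \<bar>real j - real k\<bar>" for k d
  proof -
    have "\<bar>sin (pi * (real j - real k) / real N)\<bar> = \<bar>sin (pi * real d / real N)\<bar>"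
    proof (cases "j \<ge> k")
      case True
      thus ?thesis using that by simp
    next
      case False
      hence "real j - real k = - real d"
        using that by simp
      hence "pi * (real j - real k) / real N = - (pi * real d / real N)"
        by simp
      thus ?thesis by (simp only: sin_minus abs_minus_cancel)
    qed
    thus ?thesis
      using sin_ge[of d] that equally_spaced_norm_diff[OF assms(1,2) that(1)] by simp
  qed
  \<comment> \<open>The row is split at j because k -> |j - k| is injective on each side separately.
    Each side costs at most 6N/L, whence the constant 12.\<close>
  have "(\<Sum>k=1..N. exp (- L\<^sup>2 * (norm (\<xi> j - \<xi> k))\<^sup>2 / 4))
      = (\<Sum>k=1..j. exp (- L\<^sup>2 * (norm (\<xi> j - \<xi> k))\<^sup>2 / 4))
        + (\<Sum>k=Suc j..N. exp (- L\<^sup>2 * (norm (\<xi> j - \<xi> k))\<^sup>2 / 4))"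
    using assms(2) sum.ub_add_nat[of 1 j _ "N - j"] by simp
  also have "(\<Sum>k=1..j. exp (- L\<^sup>2 * (norm (\<xi> j - \<xi> k))\<^sup>2 / 4)) \<le> (\<Sum>k=1..j. h (j - k) + h (N - (j - k)))"
    using assms(2) by (intro sum_mono dist) (auto simp: of_nat_diff)
  also have "(\<Sum>k=1..j. h (j - k) + h (N - (j - k))) = (\<Sum>d\<in>(\<lambda>k. j - k) ` {1..j}. h d + h (N - d))"
    by (subst sum.reindex) (auto simp: inj_on_def)
  also have "\<dots> \<le> (\<Sum>d\<le>N. h d + h (N - d))"
    using assms(2) h_nonneg by (intro sum_mono2) auto
  also have "(\<Sum>k=Suc j..N. exp (- L\<^sup>2 * (norm (\<xi> j - \<xi> k))\<^sup>2 / 4))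
      \<le> (\<Sum>k=Suc j..N. h (k - j) + h (N - (k - j)))"
    using assms(2) by (intro sum_mono dist) (auto simp: of_nat_diff)
  also have "(\<Sum>k=Suc j..N. h (k - j) + h (N - (k - j))) = (\<Sum>d\<in>(\<lambda>k. k - j) ` {Suc j..N}. h d + h (N - d))"
    by (subst sum.reindex) (auto simp: inj_on_def)
  also have "\<dots> \<le> (\<Sum>d\<le>N. h d + h (N - d))"
    using h_nonneg by (intro sum_mono2) auto
  finally show ?thesis
    using h_sum' by simp
qed

text \<open>Enough directions lie within about N/(2L) steps of the j-th one; these are at distance
  at most pi/L, where the Gaussian is bounded below by an absolute constant.\<close>

lemma sum_gaussian_chord_ge:
  fixes L :: real
  assumes "equally_spaced N \<xi>" "j \<in> {1..N}" "L \<ge> 1"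
  shows "exp (- 5) * real N / (2 * L) \<le> (\<Sum>k=1..N. exp (- L\<^sup>2 * (norm (\<xi> j - \<xi> k))\<^sup>2 / 8))"
proof -
  \<comment> \<open>The window below has m + 1 elements, counting j itself, so its size is at least
    N/(2L) even when the floor is 0.\<close>
  define m where "m = nat \<lfloor>real N / (2 * L)\<rfloor>"
  have m_le: "real m \<le> real N / (2 * L)" and m_ge: "real N / (2 * L) \<le> real (Suc m)"
    using assms(3) unfolding m_def by (simp_all add: of_nat_floor) linarith
  have "real N / (2 * L) \<le> real N / 2"
    using assms(3) by (intro divide_left_mono) auto
  hence m2: "2 * m \<le> N"
    using m_le by linarith
  \<comment> \<open>A one-sided window avoids wrapping around: since 2m is at most N, it fits to the
    right of j or else to the left.\<close>
  obtain K where K: "K \<subseteq> {1..N}" "card K = Suc m" "\<And>k. k \<in> K \<Longrightarrow> \<bar>real j - real k\<bar> \<le> real m"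
  proof (cases "j + m \<le> N")
    case True
    thus ?thesis
      using assms(2) by (intro that[of "{j..j+m}"]) auto
  next
    case False
    thus ?thesis
      using assms(2) m2 by (intro that[of "{j-m..j}"]) auto
  qed
  \<comment> \<open>Estimating pi by 4 makes the exponent at least -16/8 = -2, so exp(-5) is a
    generous lower bound.\<close>
  have near: "exp (- 5) \<le> exp (- L\<^sup>2 * (norm (\<xi> j - \<xi> k))\<^sup>2 / 8)" if "k \<in> K" for k
  proof -
    have N: "real N > 0"
      using assms(2) by auto
    have "\<bar>sin (pi * (real j - real k) / real N)\<bar> \<le> \<bar>pi * (real j - real k) / real N\<bar>"
      by (rule abs_sin_x_le_abs_x)
    also have "\<dots> = pi * \<bar>real j - real k\<bar> / real N"
      by (simp add: abs_mult)
    also have "\<dots> \<le> pi * (real N / (2 * L)) / real N"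
      using K(3)[OF that] m_le by (intro divide_right_mono mult_left_mono) auto
    also have "\<dots> = pi / (2 * L)"
      using N by simp
    finally have "norm (\<xi> j - \<xi> k) \<le> pi / L"
      using equally_spaced_norm_diff[OF assms(1,2), of k] K(1) that by auto
    hence "L * norm (\<xi> j - \<xi> k) \<le> pi"
      using assms(3) by (simp add: field_simps)
    also have "\<dots> \<le> 4"
      using pi_less_4 by simp
    finally have "(L * norm (\<xi> j - \<xi> k))\<^sup>2 \<le> 4\<^sup>2"
      using assms(3) by (intro power_mono) auto
    thus ?thesis
      by (simp add: power_mult_distrib)
  qed
  have "exp (- 5) * real N / (2 * L) = exp (- 5) * (real N / (2 * L))"
    by simp
  also have "\<dots> \<le> exp (- 5) * real (Suc m)"
    using m_ge by (intro mult_left_mono) auto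
  also have "\<dots> = (\<Sum>k\<in>K. exp (- 5))"
    using K(2) by simp
  also have "\<dots> \<le> (\<Sum>k\<in>K. exp (- L\<^sup>2 * (norm (\<xi> j - \<xi> k))\<^sup>2 / 8))"
    by (intro sum_mono near)
  also have "\<dots> \<le> (\<Sum>k=1..N. exp (- L\<^sup>2 * (norm (\<xi> j - \<xi> k))\<^sup>2 / 8))"
    using K(1) by (intro sum_mono2) auto
  finally show ?thesis .
qed

section \<open>First and second moments of the random signs\<close>

lemma (in prob_space) random_sign_AE:
  assumes [measurable]: "X \<in> borel_measurable M"
    and "prob {\<omega> \<in> space M. X \<omega> = 1} = p" "prob {\<omega> \<in> space M. X \<omega> = - 1} = 1 - p"
  shows "AE \<omega> in M. X \<omega> = 1 \<or> X \<omega> = (- 1 :: real)"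
proof -
  let ?S = "\<lambda>c. {\<omega> \<in> space M. X \<omega> = c}"
  have "prob (?S 1 \<union> ?S (- 1)) = prob (?S 1) + prob (?S (- 1))"
    by (intro finite_measure_Union) auto
  hence "AE \<omega> in M. \<omega> \<in> ?S 1 \<union> ?S (- 1)"
    using assms by (subst AE_in_set_eq_1) auto
  thus ?thesis
    by eventually_elim auto
qed

text \<open>Almost surely X is the indicator of {X = 1} minus that of {X = -1}, with mean p - (1 -
  p); integrability comes from boundedness.\<close>

lemma (in prob_space) random_sign_expectation:
  assumes [measurable]: "X \<in> borel_measurable M"
    and p: "prob {\<omega> \<in> space M. X \<omega> = 1} = p" "prob {\<omega> \<in> space M. X \<omega> = - 1} = 1 - p"
  shows "integrable M X" "expectation X = (2 * p - 1 :: real)"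
proof -
  let ?S = "\<lambda>c. {\<omega> \<in> space M. X \<omega> = c}"
  have ae: "AE \<omega> in M. X \<omega> = 1 \<or> X \<omega> = - 1"
    using assms by (rule random_sign_AE)
  show "integrable M X"
    using ae by (intro integrable_const_bound[where B = 1]) (auto elim: eventually_mono)
  have "expectation X = expectation (\<lambda>\<omega>. indicator (?S 1) \<omega> - indicator (?S (- 1)) \<omega>)"
  proof (rule integral_cong_AE)
    show "AE \<omega> in M. X \<omega> = indicator (?S 1) \<omega> - indicator (?S (- 1)) \<omega>"
      using ae AE_space by eventually_elim (auto simp: indicator_def)
  qed auto
  also have "\<dots> = p - (1 - p)"
    by (subst Bochner_Integration.integral_diff) (auto simp: emeasure_eq_measure p)
  finally show "expectation X = 2 * p - 1"
    by simp
qed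

text \<open>The square of a sign is 1 almost surely, and for distinct indices independence factors
  the expectation into two means 2p - 1.\<close>

lemma random_signs_second_moment:
  assumes "random_signs M N p Cf" "j \<in> {1..N}" "k \<in> {1..N}"
  shows "has_bochner_integral M (\<lambda>\<omega>. Cf j \<omega> * Cf k \<omega>) (if j = k then 1 else (2 * p - 1)\<^sup>2)"
proof -
  interpret prob_space M
    using assms by (simp add: random_signs_def)
  have ind: "indep_vars (\<lambda>_. borel) Cf {1..N}"
    using assms by (simp add: random_signs_def)
  have meas: "Cf i \<in> borel_measurable M" if "i \<in> {1..N}" for i
    using ind that by (auto simp: indep_vars_def)
  have p: "prob {\<omega> \<in> space M. Cf i \<omega> = 1} = p" "prob {\<omega> \<in> space M. Cf i \<omega> = - 1} = 1 - p"
    if "i \<in> {1..N}" for i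
    using assms(1) that by (auto simp: random_signs_def)
  note E = random_sign_expectation[OF meas p]
  show ?thesis
  proof (cases "j = k")
    case True
    have [measurable]: "Cf k \<in> borel_measurable M"
      by (rule meas) fact
    have "has_bochner_integral M (\<lambda>_. 1 :: real) 1"
      by (simp add: has_bochner_integral_iff prob_space)
    moreover have "AE \<omega> in M. 1 = Cf k \<omega> * Cf k \<omega>"
      using random_sign_AE[OF meas p, OF assms(3,3,3)] by eventually_elim auto
    ultimately show ?thesis
      unfolding True by (subst (asm) has_bochner_integral_cong_AE[where g = "\<lambda>\<omega>. Cf k \<omega> * Cf k \<omega>"]) auto
  next
    case False
    have "indep_vars (\<lambda>_. borel) Cf {j, k}"
      using ind assms by (rule_tac indep_vars_subset) auto
    thus ?thesis
      using False E[OF assms(2,2,2)] E[OF assms(3,3,3)]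
        indep_vars_lebesgue_integral[of "{j, k}" Cf] indep_vars_integrable[of "{j, k}" Cf]
      by (auto simp: has_bochner_integral_iff power2_eq_square)
  qed
qed

section \<open>Squared modulus and norm of the wave\<close>

lemma cmod_wave_squared:
  "(cmod (wave lam N \<xi> b x))\<^sup>2
    = (\<Sum>j=1..N. \<Sum>k=1..N. b j * b k * cos (x \<bullet> (lam *\<^sub>R (\<xi> j - \<xi> k))))"
proof -
  let ?t = "\<lambda>j. lam * (x \<bullet> \<xi> j)"
  have "Re (wave lam N \<xi> b x) = (\<Sum>j=1..N. b j * cos (?t j))"
    "Im (wave lam N \<xi> b x) = (\<Sum>j=1..N. b j * sin (?t j))"
    by (simp_all add: wave_def Re_exp Im_exp)
  hence "(cmod (wave lam N \<xi> b x))\<^sup>2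
    = (\<Sum>j=1..N. \<Sum>k=1..N. b j * cos (?t j) * (b k * cos (?t k)) + b j * sin (?t j) * (b k * sin (?t k)))"
    by (simp only: cmod_power2 power2_eq_square[of "sum _ _"] sum_product sum.distrib)
  \<comment> \<open>The addition formula for cosine merges the two products. The factor
    \<open>lam\<close> moves into the second argument of the inner product, which then matches the
    frequency \<open>\<eta>\<close> of the Gaussian integrals.\<close>
  also have "\<dots> = (\<Sum>j=1..N. \<Sum>k=1..N. b j * b k * cos (x \<bullet> (lam *\<^sub>R (\<xi> j - \<xi> k))))"
    by (intro sum.cong refl) (simp add: inner_diff_right right_diff_distrib cos_diff algebra_simps)
  finally show ?thesis .
qed

lemma L2norm_squared: "(L2norm f)\<^sup>2 = (LINT x|lborel. (cmod (f x))\<^sup>2)"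
  by (simp add: L2norm_def)

section \<open>Gaussian bounds for the squared cut-off\<close>

lemma cutoff_continuous: "cutoff a \<Longrightarrow> continuous_on UNIV a"
  unfolding cutoff_def smooth_def
  by (metis differentiable_imp_continuous_on funpow_0)

lemma cutoff_support:
  assumes "cutoff a" "t \<notin> {-2..2}"
  shows "a t = 0"
  using assms closure_subset[of "{t. a t \<noteq> 0}"] unfolding cutoff_def by blast

lemma cutoff_gaussian_upper:
  assumes "cutoff a"
  obtains A where "A > 0" "\<And>t. (a t)\<^sup>2 \<le> A * exp (- t\<^sup>2)"
proof -
  have "compact (a ` {-2..2})"
    using cutoff_continuous[OF assms] by (intro compact_continuous_image) (auto intro: continuous_on_subset)
  then obtain K where K: "\<And>t. t \<in> {-2..2} \<Longrightarrow> \<bar>a t\<bar> \<le> K"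
    by (force dest!: compact_imp_bounded simp: bounded_iff)
  have "K \<ge> 0"
    using K[of 0] by auto
  show thesis
  proof (rule that)
    \<comment> \<open>K bounds |a| on [-2,2], where exp(-t^2) is at least exp(-4); the factor exp 4
      compensates for this, and the summand 1 makes positivity immediate.\<close>
    show "(K\<^sup>2 + 1) * exp 4 > 0"
      by (simp add: add_nonneg_pos)
    fix t
    show "(a t)\<^sup>2 \<le> (K\<^sup>2 + 1) * exp 4 * exp (- t\<^sup>2)"
    proof (cases "t \<in> {-2..2}")
      case True
      hence "t\<^sup>2 \<le> 2\<^sup>2"
        by (intro abs_le_square_iff[THEN iffD1]) auto
      hence "1 \<le> exp (4 - t\<^sup>2)"
        by simp
      moreover have "(a t)\<^sup>2 \<le> K\<^sup>2"
        using K[OF True] \<open>K \<ge> 0\<close> by (intro abs_le_square_iff[THEN iffD1]) auto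
      ultimately have "(a t)\<^sup>2 * 1 \<le> (K\<^sup>2 + 1) * exp (4 - t\<^sup>2)"
        by (intro mult_mono) auto
      thus ?thesis
        by (simp add: exp_diff exp_minus field_simps)
    qed (simp add: cutoff_support[OF assms])
  qed
qed

text \<open>The factor exp(-1) places the sign change of the difference at t = 1: up to there it is
  at most 1 = a(t)^2, and beyond it is nonpositive.\<close>

lemma cutoff_gaussian_lower:
  assumes "cutoff a" "t \<ge> 0"
  shows "exp (- 2 * t\<^sup>2) - exp (- 1) * exp (- t\<^sup>2) \<le> (a t)\<^sup>2"
proof (cases "t \<le> 1")
  case True
  hence "a t = 1"
    using assms by (auto simp: cutoff_def)
  moreover have "exp (- 2 * t\<^sup>2) \<le> 1"
    by simp
  moreover have "0 \<le> exp (- 1) * exp (- t\<^sup>2)"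
    by simp
  ultimately show ?thesis
    by (simp only: one_power2)
next
  case False
  hence "1 \<le> t\<^sup>2"
    by simp
  hence "exp (- 2 * t\<^sup>2) \<le> exp (- 1 + - t\<^sup>2)"
    by simp
  thus ?thesis
    unfolding exp_add using zero_le_power2[of "a t"] by linarith
qed

section \<open>The expected density and the expected energy\<close>

text \<open>Separates an incoherent diagonal part from a coherent full double sum; for q in [0,1]
  both enter with nonnegative weights.\<close>

lemma sum_if_diagonal:
  fixes f :: "'i \<Rightarrow> 'i \<Rightarrow> real"
  assumes "finite I"
  shows "(\<Sum>j\<in>I. \<Sum>k\<in>I. (if j = k then 1 else q) * f j k)
    = (1 - q) * (\<Sum>j\<in>I. f j j) + q * (\<Sum>j\<in>I. \<Sum>k\<in>I. f j k)"
proof -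
  have "(if j = k then 1 else q) * f j k = (1 - q) * (if j = k then f j k else 0) + q * f j k" for j k
    by (simp add: algebra_simps)
  thus ?thesis
    using assms by (simp add: sum.distrib sum.delta flip: sum_distrib_left)
qed

text \<open>For q = (2p - 1)^2 this is E|u(x)|^2.\<close>

definition expected_density :: "real \<Rightarrow> nat \<Rightarrow> (nat \<Rightarrow> real^2) \<Rightarrow> real \<Rightarrow> real^2 \<Rightarrow> real" where
  "expected_density lam N \<xi> q x =
    (\<Sum>j=1..N. \<Sum>k=1..N. (if j = k then 1 else q) * cos (x \<bullet> (lam *\<^sub>R (\<xi> j - \<xi> k))))"

text \<open>The density is a convex combination of N and of the squared modulus of the wave with all
  coefficients 1.\<close>

lemma expected_density_nonneg:
  assumes "0 \<le> q" "q \<le> 1"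
  shows "0 \<le> expected_density lam N \<xi> q x"
proof -
  have "expected_density lam N \<xi> q x = (1 - q) * real N + q * (cmod (wave lam N \<xi> (\<lambda>_. 1) x))\<^sup>2"
    unfolding expected_density_def cmod_wave_squared by (subst sum_if_diagonal) auto
  thus ?thesis
    using assms by simp
qed

lemma gaussian_expected_density:
  assumes "b > 0"
  shows "has_bochner_integral lborel (\<lambda>x. exp (- b * (norm x)\<^sup>2) * expected_density lam N \<xi> q x)
    (pi / b * (\<Sum>j=1..N. \<Sum>k=1..N. (if j = k then 1 else q) * exp (- lam\<^sup>2 * (norm (\<xi> j - \<xi> k))\<^sup>2 / (4 * b))))"
proof -
  have "has_bochner_integral lborel
    (\<lambda>x. \<Sum>j=1..N. \<Sum>k=1..N. (if j = k then 1 else q) *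
        (exp (- b * (norm x)\<^sup>2) * cos (x \<bullet> (lam *\<^sub>R (\<xi> j - \<xi> k)))))
    (\<Sum>j=1..N. \<Sum>k=1..N. (if j = k then 1 else q) *
        (pi / b * exp (- (norm (lam *\<^sub>R (\<xi> j - \<xi> k)))\<^sup>2 / (4 * b))))"
    by (intro has_bochner_integral_sum has_bochner_integral_mult_right gaussian_has_cosine_integral assms)
  thus ?thesis
    unfolding expected_density_def sum_distrib_left by (simp add: power_mult_distrib mult_ac)
qed

text \<open>The energy is a finite quadratic form in the signs with deterministic coefficients
  \<open>I j k\<close>, so expectation and spatial integral are exchanged by linearity and only
  second moments enter.\<close>

lemma expected_energy:
  assumes "random_signs M N p Cf"
    and "integrable lborel (\<lambda>x. (w x)\<^sup>2)"
  shows "(LINT \<omega>|M. (L2norm (\<lambda>x. complex_of_real (w x) * wave lam N \<xi> (\<lambda>j. Cf j \<omega>) x))\<^sup>2)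
      = (LINT x|lborel. (w x)\<^sup>2 * expected_density lam N \<xi> ((2 * p - 1)\<^sup>2) x)"
    and "integrable lborel (\<lambda>x. (w x)\<^sup>2 * expected_density lam N \<xi> q x)"
proof -
  define I where "I = (\<lambda>j k. LINT x|lborel. (w x)\<^sup>2 * cos (x \<bullet> (lam *\<^sub>R (\<xi> j - \<xi> k))))"
  have [measurable]: "(\<lambda>x. (w x)\<^sup>2) \<in> borel_measurable borel"
    using borel_measurable_integrable[OF assms(2)] by simp
  have "integrable lborel (\<lambda>x. (w x)\<^sup>2 * cos (x \<bullet> (lam *\<^sub>R (\<xi> j - \<xi> k))))" for j k
    by (rule Bochner_Integration.integrable_bound[OF assms(2)]) (auto simp: abs_mult intro!: mult_left_le)
  hence I: "has_bochner_integral lborel (\<lambda>x. (w x)\<^sup>2 * cos (x \<bullet> (lam *\<^sub>R (\<xi> j - \<xi> k)))) (I j k)" for j k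
    by (simp add: has_bochner_integral_iff I_def)
  \<comment> \<open>The matrix m is arbitrary so that one identity serves both the random products
    \<open>Cf j \<omega> * Cf k \<omega>\<close> and their expectations.\<close>
  have *: "has_bochner_integral lborel
      (\<lambda>x. (w x)\<^sup>2 * (\<Sum>j=1..N. \<Sum>k=1..N. m j k * cos (x \<bullet> (lam *\<^sub>R (\<xi> j - \<xi> k)))))
      (\<Sum>j=1..N. \<Sum>k=1..N. m j k * I j k)" for m
  proof -
    have "has_bochner_integral lborel
        (\<lambda>x. \<Sum>j=1..N. \<Sum>k=1..N. m j k * ((w x)\<^sup>2 * cos (x \<bullet> (lam *\<^sub>R (\<xi> j - \<xi> k)))))
        (\<Sum>j=1..N. \<Sum>k=1..N. m j k * I j k)"
      by (intro has_bochner_integral_sum has_bochner_integral_mult_right I)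
    thus ?thesis
      unfolding sum_distrib_left by (simp only: mult.left_commute)
  qed
  show "integrable lborel (\<lambda>x. (w x)\<^sup>2 * expected_density lam N \<xi> q x)"
    unfolding expected_density_def using * by (rule integrable.intros)
  have "(L2norm (\<lambda>x. complex_of_real (w x) * wave lam N \<xi> (\<lambda>j. Cf j \<omega>) x))\<^sup>2
      = (\<Sum>j=1..N. \<Sum>k=1..N. Cf j \<omega> * Cf k \<omega> * I j k)" for \<omega>
    unfolding L2norm_squared norm_mult power_mult_distrib cmod_wave_squared
    using *[of "\<lambda>j k. Cf j \<omega> * Cf k \<omega>"] by (simp add: has_bochner_integral_iff)
  moreover have "has_bochner_integral M (\<lambda>\<omega>. \<Sum>j=1..N. \<Sum>k=1..N. Cf j \<omega> * Cf k \<omega> * I j k)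
      (\<Sum>j=1..N. \<Sum>k=1..N. (if j = k then 1 else (2 * p - 1)\<^sup>2) * I j k)"
    by (intro has_bochner_integral_sum has_bochner_integral_mult_left random_signs_second_moment[OF assms(1)])
  moreover have "(LINT x|lborel. (w x)\<^sup>2 * expected_density lam N \<xi> ((2 * p - 1)\<^sup>2) x)
      = (\<Sum>j=1..N. \<Sum>k=1..N. (if j = k then 1 else (2 * p - 1)\<^sup>2) * I j k)"
    unfolding expected_density_def using * by (rule has_bochner_integral_integral_eq)
  ultimately show "(LINT \<omega>|M. (L2norm (\<lambda>x. complex_of_real (w x) * wave lam N \<xi> (\<lambda>j. Cf j \<omega>) x))\<^sup>2)
      = (LINT x|lborel. (w x)\<^sup>2 * expected_density lam N \<xi> ((2 * p - 1)\<^sup>2) x)"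
    by (simp add: has_bochner_integral_iff)
qed

section \<open>Chord sums with the second-moment weights\<close>

lemma weighted_chord_sum_le:
  fixes L q :: real
  assumes "equally_spaced N \<xi>" "L \<ge> 1" "real N \<ge> L" "0 \<le> q" "q \<le> 1"
  shows "(\<Sum>j=1..N. \<Sum>k=1..N. (if j = k then 1 else q) * exp (- L\<^sup>2 * (norm (\<xi> j - \<xi> k))\<^sup>2 / 4))
    \<le> 12 * (real N + q * (real N)\<^sup>2 / L)"
proof -
  have "(\<Sum>j=1..N. \<Sum>k=1..N. exp (- L\<^sup>2 * (norm (\<xi> j - \<xi> k))\<^sup>2 / 4)) \<le> (\<Sum>j=1..N. 12 * real N / L)"
    using assms by (intro sum_mono sum_gaussian_chord_le)
  also have "\<dots> = 12 * (real N)\<^sup>2 / L"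
    by (simp add: power2_eq_square)
  finally have "q * (\<Sum>j=1..N. \<Sum>k=1..N. exp (- L\<^sup>2 * (norm (\<xi> j - \<xi> k))\<^sup>2 / 4)) \<le> q * (12 * (real N)\<^sup>2 / L)"
    using assms by (intro mult_left_mono)
  moreover have "(1 - q) * real N \<le> 1 * real N"
    using assms by (intro mult_right_mono) auto
  ultimately show ?thesis
    by (subst sum_if_diagonal) (auto simp: mult_ac)
qed

text \<open>The sum dominates N through its diagonal and exp(-5)/2 times q N^2/L through the row
  estimate; averaging the two bounds gives the factor exp(-5)/4.\<close>

lemma weighted_chord_sum_ge:
  fixes L q :: real
  assumes "equally_spaced N \<xi>" "L \<ge> 1" "0 \<le> q" "q \<le> 1"
  shows "exp (- 5) / 4 * (real N + q * (real N)\<^sup>2 / L)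
    \<le> (\<Sum>j=1..N. \<Sum>k=1..N. (if j = k then 1 else q) * exp (- L\<^sup>2 * (norm (\<xi> j - \<xi> k))\<^sup>2 / 8))"
    (is "_ \<le> ?S")
proof -
  let ?K = "\<lambda>j k. exp (- L\<^sup>2 * (norm (\<xi> j - \<xi> k))\<^sup>2 / 8)"
  have S: "?S = (1 - q) * real N + q * (\<Sum>j=1..N. \<Sum>k=1..N. ?K j k)"
    by (subst sum_if_diagonal) auto
  have "(\<Sum>j=1..N. 1) \<le> (\<Sum>j=1..N. \<Sum>k=1..N. ?K j k)"
  proof (rule sum_mono)
    fix j assume "j \<in> {1..N}"
    hence "?K j j \<le> (\<Sum>k=1..N. ?K j k)"
      by (intro member_le_sum) auto
    thus "1 \<le> (\<Sum>k=1..N. ?K j k)"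
      by simp
  qed
  hence "q * real N \<le> q * (\<Sum>j=1..N. \<Sum>k=1..N. ?K j k)"
    using assms by (intro mult_left_mono) auto
  hence diag: "real N \<le> ?S"
    unfolding S by (simp add: left_diff_distrib)
  have "exp (- 5) / 2 * ((real N)\<^sup>2 / L) = (\<Sum>j=1..N. exp (- 5) * real N / (2 * L))"
    by (simp add: power2_eq_square)
  also have "\<dots> \<le> (\<Sum>j=1..N. \<Sum>k=1..N. ?K j k)"
    using assms by (intro sum_mono sum_gaussian_chord_ge)
  finally have "q * (exp (- 5) / 2 * ((real N)\<^sup>2 / L)) \<le> q * (\<Sum>j=1..N. \<Sum>k=1..N. ?K j k)"
    using assms by (intro mult_left_mono)
  also have "\<dots> \<le> ?S"
    unfolding S using assms by simp
  finally have "exp (- 5) / 2 * (q * (real N)\<^sup>2 / L) \<le> ?S"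
    by (simp add: mult_ac)
  moreover have "exp (- 5) / 2 * real N \<le> 1 * real N"
    using order.trans[of "exp (- 5)" 1 "2::real"] by (intro mult_right_mono) auto
  ultimately show ?thesis
    using diag by (simp add: algebra_simps)
qed

section \<open>The two-sided bound for the expected energy\<close>

theorem theorem0p2:
  fixes \<alpha> :: real and a :: "real \<Rightarrow> real"
  assumes "0 < \<alpha>" and "\<alpha> < 1" and "cutoff a"
  shows "\<exists>c C \<gamma>0 lam0 :: real. c > 0 \<and> C > 0 \<and> \<gamma>0 \<ge> 1 \<and> lam0 \<ge> 1 \<and>
    (\<forall>lam \<gamma> p :: real. \<forall>N :: nat. \<forall>\<xi> :: nat \<Rightarrow> real^2.
     \<forall>(M :: 'w measure) (Cf :: nat \<Rightarrow> 'w \<Rightarrow> real).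
       lam \<ge> lam0 \<longrightarrow> \<gamma> \<ge> \<gamma>0 \<longrightarrow> real N = \<gamma> * lam \<longrightarrow> 0 \<le> p \<longrightarrow> p \<le> 1 \<longrightarrow>
       equally_spaced N \<xi> \<longrightarrow> random_signs M N p Cf \<longrightarrow>
       (let E = (LINT \<omega>|M. (L2norm (\<lambda>x. complex_of_real (scaled_cutoff a \<alpha> lam x) *
                                      wave lam N \<xi> (\<lambda>j. Cf j \<omega>) x))\<^sup>2);
            B = \<gamma> * lam powr (1 - 2 * \<alpha>) + (2 * p - 1)\<^sup>2 * \<gamma>\<^sup>2 * lam powr (1 - \<alpha>)
        in c * B \<le> E \<and> E \<le> C * B))"
proof -
  obtain A where A: "A > 0" "\<And>t. (a t)\<^sup>2 \<le> A * exp (- t\<^sup>2)"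
    using cutoff_gaussian_upper[OF assms(3)] by blast
  \<comment> \<open>The factor 1/10 is 1/2 - 2/5, what survives of the positive Gaussian after the
    subtracted one is absorbed; exp(-5)/4 and the 12 in \<open>C\<close> come from the weighted
    chord sums.\<close>
  define c where "c = pi / 10 * (exp (- 5) / 4)"
  define C where "C = A * pi * 12"
  have main: "c * (\<gamma> * lam powr (1 - 2 * \<alpha>) + (2 * p - 1)\<^sup>2 * \<gamma>\<^sup>2 * lam powr (1 - \<alpha>)) \<le> E
      \<and> E \<le> C * (\<gamma> * lam powr (1 - 2 * \<alpha>) + (2 * p - 1)\<^sup>2 * \<gamma>\<^sup>2 * lam powr (1 - \<alpha>))"
    if lam: "lam \<ge> 1" and \<gamma>: "\<gamma> \<ge> 1" and N: "real N = \<gamma> * lam" and p: "0 \<le> p" "p \<le> 1"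
      and \<xi>: "equally_spaced N \<xi>" and signs: "random_signs M N p Cf"
      and E: "E = (LINT \<omega>|M. (L2norm (\<lambda>x. complex_of_real (scaled_cutoff a \<alpha> lam x) *
                                      wave lam N \<xi> (\<lambda>j. Cf j \<omega>) x))\<^sup>2)"
    for lam \<gamma> p E :: real and N \<xi> and M :: "'w measure" and Cf
  proof -
    define q where "q = (2 * p - 1)\<^sup>2"
    have q: "0 \<le> q" "q \<le> 1"
      using p abs_square_le_1[of "2 * p - 1"] by (auto simp: q_def)
    \<comment> \<open>1/s is the length scale of the cut-off, and L = lam/s is the frequency of the
      wave measured on that scale.\<close>
    define s where "s = lam powr \<alpha>"
    define L where "L = lam powr (1 - \<alpha>)"
    have s: "s > 0"
      using lam by (simp add: s_def)
    have Ls: "L * s = lam"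
      using lam by (simp add: s_def L_def flip: powr_add)
    have L: "L \<ge> 1"
      using lam assms(2) by (simp add: L_def ge_one_powr_ge_zero)
    have "L \<le> lam powr 1"
      unfolding L_def using lam assms(1) by (intro powr_mono) auto
    also have "\<dots> \<le> real N"
      using lam \<gamma> by (simp add: N)
    finally have LN: "L \<le> real N" .
    define B where "B = real N + q * (real N)\<^sup>2 / L"
    \<comment> \<open>In terms of N, L and s the target is the size of the weighted chord sums times
      the area scale 1/s^2, because lam^2 = L^2 s^2.\<close>
    have B: "\<gamma> * lam powr (1 - 2 * \<alpha>) + (2 * p - 1)\<^sup>2 * \<gamma>\<^sup>2 * lam powr (1 - \<alpha>) = B / s\<^sup>2"
    proof -
      have "lam powr (1 - 2 * \<alpha>) = lam / s\<^sup>2"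
        using lam by (simp add: s_def powr_diff mult.commute[of 2] power2_eq_square flip: powr_add)
      moreover have "L = lam\<^sup>2 / (L * s\<^sup>2)"
        using L s by (simp add: power2_eq_square field_simps flip: Ls)
      hence "q * \<gamma>\<^sup>2 * L = q * \<gamma>\<^sup>2 * (lam\<^sup>2 / (L * s\<^sup>2))"
        by (rule arg_cong)
      ultimately show ?thesis
        unfolding B_def N q_def[symmetric] L_def[symmetric]
        by (simp add: add_divide_distrib power_mult_distrib mult_ac)
    qed
    define S where "S = (\<lambda>b. \<Sum>j=1..N. \<Sum>k=1..N. (if j = k then 1 else q) *
      exp (- L\<^sup>2 * (norm (\<xi> j - \<xi> k))\<^sup>2 / b))"
    \<comment> \<open>Using b s^2 as the Gaussian parameter replaces lam by L in the exponents, as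
      lam = L s.\<close>
    have G: "has_bochner_integral lborel (\<lambda>x. exp (- b * (s * norm x)\<^sup>2) * expected_density lam N \<xi> q x)
        (pi / (b * s\<^sup>2) * S (4 * b))" if "b > 0" for b
    proof -
      have scale: "- lam\<^sup>2 * t / (4 * (b * s\<^sup>2)) = - L\<^sup>2 * t / (4 * b)" for t
        using s by (simp add: power_mult_distrib flip: Ls)
      have "- (b * s\<^sup>2) * (norm x)\<^sup>2 = - b * (s * norm x)\<^sup>2" for x :: "real^2"
        by (simp add: power_mult_distrib)
      moreover have "b * s\<^sup>2 > 0"
        using that s by simp
      ultimately show ?thesis
        using gaussian_expected_density[of "b * s\<^sup>2" lam N \<xi> q] by (simp only: scale S_def)
    qed
    have bounds: "exp (- 2 * (s * norm x)\<^sup>2) - exp (- 1) * exp (- (s * norm x)\<^sup>2) \<le> (scaled_cutoff a \<alpha> lam x)\<^sup>2"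
        "(scaled_cutoff a \<alpha> lam x)\<^sup>2 \<le> A * exp (- (s * norm x)\<^sup>2)" for x
      using s cutoff_gaussian_lower[OF assms(3), of "s * norm x"] A(2)[of "s * norm x"]
      by (auto simp: scaled_cutoff_def s_def)
    have w_int: "integrable lborel (\<lambda>x. (scaled_cutoff a \<alpha> lam x)\<^sup>2)"
    proof (rule Bochner_Integration.integrable_bound)
      \<comment> \<open>At frequency 0 the cosine is 1, which leaves the integrability of the
        dominating Gaussian itself.\<close>
      have "has_bochner_integral lborel (\<lambda>x::real^2. exp (- (s\<^sup>2) * (norm x)\<^sup>2) * cos (x \<bullet> 0))
          (pi / s\<^sup>2 * exp (- (norm (0::real^2))\<^sup>2 / (4 * s\<^sup>2)))"
        using s by (intro gaussian_has_cosine_integral) simp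
      thus "integrable lborel (\<lambda>x::real^2. A * exp (- (s * norm x)\<^sup>2))"
        by (auto simp: has_bochner_integral_iff power_mult_distrib)
      have [measurable]: "a \<in> borel_measurable borel"
        using cutoff_continuous[OF assms(3)] by (rule borel_measurable_continuous_onI)
      show "(\<lambda>x. (scaled_cutoff a \<alpha> lam x)\<^sup>2) \<in> borel_measurable lborel"
        unfolding scaled_cutoff_def by measurable
      show "AE x in lborel. norm ((scaled_cutoff a \<alpha> lam x)\<^sup>2) \<le> norm (A * exp (- (s * norm (x::real^2))\<^sup>2))"
        using bounds(2) A(1) by (simp add: abs_mult)
    qed
    note E_eq = expected_energy(1)[OF signs w_int, of lam \<xi>, folded E q_def]
    \<comment> \<open>Nonnegativity allows both pointwise bounds on the squared cut-off to be
      multiplied by the density and integrated.\<close>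
    note P = expected_density_nonneg[OF q, of lam N \<xi>]
    have G1: "has_bochner_integral lborel (\<lambda>x. exp (- 1 * (s * norm x)\<^sup>2) * expected_density lam N \<xi> q x)
        (pi / s\<^sup>2 * S 4)"
      and G2: "has_bochner_integral lborel (\<lambda>x. exp (- 2 * (s * norm x)\<^sup>2) * expected_density lam N \<xi> q x)
        (pi / (2 * s\<^sup>2) * S 8)"
      using G[of 1] G[of 2] by simp_all
    have "E \<le> A * (pi / s\<^sup>2 * S 4)"
    proof -
      have "E \<le> (LINT x|lborel. A * (exp (- 1 * (s * norm x)\<^sup>2) * expected_density lam N \<xi> q x))"
        unfolding E_eq
      proof (rule integral_mono)
        show "integrable lborel (\<lambda>x. A * (exp (- 1 * (s * norm x)\<^sup>2) * expected_density lam N \<xi> q x))"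
          using G1 by (intro integrable_mult_right) (simp add: has_bochner_integral_iff)
        show "(scaled_cutoff a \<alpha> lam x)\<^sup>2 * expected_density lam N \<xi> q x
            \<le> A * (exp (- 1 * (s * norm x)\<^sup>2) * expected_density lam N \<xi> q x)" for x
          using mult_right_mono[OF bounds(2) P, of x] by (simp add: mult.assoc)
      qed (rule expected_energy(2)[OF signs w_int])
      also have "\<dots> = A * (pi / s\<^sup>2 * S 4)"
        using G1 by (simp add: has_bochner_integral_iff)
      finally show ?thesis .
    qed
    also have "S 4 \<le> 12 * B"
      unfolding S_def B_def using weighted_chord_sum_le[OF \<xi> L LN q] .
    hence "A * (pi / s\<^sup>2 * S 4) \<le> A * (pi / s\<^sup>2 * (12 * B))"
      using A(1) by (intro mult_left_mono) auto
    finally have upper: "E \<le> C * (B / s\<^sup>2)"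
      by (simp add: C_def mult_ac)
    have "pi / (2 * s\<^sup>2) * S 8 - exp (- 1) * (pi / s\<^sup>2 * S 4) \<le> E"
    proof -
      have D: "has_bochner_integral lborel
          (\<lambda>x. exp (- 2 * (s * norm x)\<^sup>2) * expected_density lam N \<xi> q x
            - exp (- 1) * (exp (- 1 * (s * norm x)\<^sup>2) * expected_density lam N \<xi> q x))
          (pi / (2 * s\<^sup>2) * S 8 - exp (- 1) * (pi / s\<^sup>2 * S 4))"
        by (intro has_bochner_integral_diff has_bochner_integral_mult_right G1 G2)
      show ?thesis
        unfolding E_eq has_bochner_integral_integral_eq[OF D, symmetric]
      proof (rule integral_mono)
        show "exp (- 2 * (s * norm x)\<^sup>2) * expected_density lam N \<xi> q x
            - exp (- 1) * (exp (- 1 * (s * norm x)\<^sup>2) * expected_density lam N \<xi> q x)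
            \<le> (scaled_cutoff a \<alpha> lam x)\<^sup>2 * expected_density lam N \<xi> q x" for x
          using mult_right_mono[OF bounds(1) P, of x] by (simp add: left_diff_distrib mult.assoc)
      qed (use D expected_energy(2)[OF signs w_int] in \<open>auto simp: has_bochner_integral_iff\<close>)
    qed
    \<comment> \<open>The subtracted Gaussian is absorbed: e is at least 1 + 1 + 1/2, so exp(-1) is
      at most 2/5, and \<open>S 4\<close> is at most \<open>S 8\<close> since its exponents are more
      negative. As 2/5 < 1/2, a positive share remains.\<close>
    moreover have "exp (- 1) * (pi / s\<^sup>2 * S 4) \<le> 2 / 5 * (pi / s\<^sup>2 * S 8)"
    proof (rule mult_mono)
      show "exp (- 1) \<le> (2 / 5 :: real)"
        using exp_lower_Taylor_quadratic[of "1 :: real"] by (simp add: exp_minus field_simps)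
      have "S 4 \<le> S 8"
        unfolding S_def using q by (intro sum_mono mult_left_mono) auto
      thus "pi / s\<^sup>2 * S 4 \<le> pi / s\<^sup>2 * S 8"
        by (intro mult_left_mono) auto
      show "0 \<le> pi / s\<^sup>2 * S 4"
        unfolding S_def using q by (intro mult_nonneg_nonneg sum_nonneg) auto
    qed auto
    moreover have "pi / (2 * s\<^sup>2) * S 8 = 1 / 2 * (pi / s\<^sup>2 * S 8)"
      by simp
    ultimately have "1 / 10 * (pi / s\<^sup>2 * S 8) \<le> E"
      by linarith
    moreover have "exp (- 5) / 4 * B \<le> S 8"
      unfolding S_def B_def using weighted_chord_sum_ge[OF \<xi> L q] .
    hence "1 / 10 * (pi / s\<^sup>2 * (exp (- 5) / 4 * B)) \<le> 1 / 10 * (pi / s\<^sup>2 * S 8)"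
      by (intro mult_left_mono) auto
    ultimately have lower: "c * (B / s\<^sup>2) \<le> E"
      by (simp add: c_def mult_ac)
    show ?thesis
      unfolding B using lower upper by blast
  qed
  have "c > 0" "C > 0"
    using A(1) by (auto simp: c_def C_def)
  thus ?thesis
    using main unfolding Let_def
    \<comment> \<open>Both thresholds can be 1: \<open>\<gamma> \<ge> 1\<close> and
      \<open>lam \<ge> 1\<close> already yield L at least 1 and L at most N.\<close>
    by (intro exI[of _ c] exI[of _ C] exI[of _ 1]) auto
qed

end
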